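(* Let $r \geq 3$ and $n\geq k \geq r+3$ be integers. If $\mathcal H$ is an $n$-vertex $r$-uniform hypergraph with no Berge path of length $k$, then $$e(\mathcal H)\leq \frac{n}{k}\binom{k}{r},$$ with equality only if every connected component of $\mathcal H$ is the complete $r$-graph $K^{(r)}_{k}$.
   Context: An $r$-uniform hypergraph ($r$-graph) $\mathcal H$ is a family of (distinct) $r$-element subsets, called edges or hyperedges, of a finite vertex set $V(\mathcal H)$; $e(\mathcal H)=|\mathcal H|$ is its number of edges, and "$n$-vertex" means $|V(\mathcal H)|=n$. A Berge path of length $\ell$ in $\mathcal H$ consists of $\ell+1$ distinct vertices $v_1,\dots,v_{\ell+1}$ and $\ell$ distinct hyperedges $e_1,\dots,e_\ell$ of $\mathcal H$ such that $\{v_i,v_{i+1}\}\subseteq e_i$ for all $1\le i\le \ell$. The connected components of $\mathcal H$ are the subhypergraphs induced on the vertex sets of the connected components of its 2-shadow, i.e. of the graph on $V(\mathcal H)$ whose edges are the pairs contained in some edge of $\mathcal H$ (an isolated vertex forms a component). $K^{(r)}_k$ is the complete $r$-graph on $k$ vertices (all $r$-subsets). *)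

theory Defs
  imports Complex_Main
begin

text \<open>A hypergraph is given by its vertex set \<open>V\<close> and its set of hyperedges \<open>E\<close>.\<close>

definition uniform_hypergraph :: "nat \<Rightarrow> 'a set \<Rightarrow> 'a set set \<Rightarrow> bool" where
  "uniform_hypergraph r V E \<longleftrightarrow> finite V \<and> (\<forall>e\<in>E. e \<subseteq> V \<and> card e = r)"

text \<open>Lists are indexed from 0, so \<open>vs ! i\<close> and \<open>es ! i\<close> are the vertex \<open>v\<^sub>i\<^sub>+\<^sub>1\<close> and the
  hyperedge \<open>e\<^sub>i\<^sub>+\<^sub>1\<close>. The hyperedges may meet the path in further vertices.\<close>

definition berge_path :: "'a set \<Rightarrow> 'a set set \<Rightarrow> nat \<Rightarrow> 'a list \<Rightarrow> 'a set list \<Rightarrow> bool" where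
  "berge_path V E l vs es \<longleftrightarrow>
     length vs = l + 1 \<and> distinct vs \<and> set vs \<subseteq> V \<and>
     length es = l \<and> distinct es \<and> set es \<subseteq> E \<and>
     (\<forall>i<l. {vs ! i, vs ! (i + 1)} \<subseteq> es ! i)"

definition two_shadow :: "'a set set \<Rightarrow> 'a set set" where
  "two_shadow E = {p. card p = 2 \<and> (\<exists>e\<in>E. p \<subseteq> e)}"

text \<open>Vertex sets of the connected components of the graph with vertex set \<open>V\<close> and edge set \<open>G\<close>.
  The reflexive closure makes every isolated vertex of \<open>V\<close> a component of its own.\<close>

definition graph_components :: "'a set \<Rightarrow> 'a set set \<Rightarrow> 'a set set" where
  "graph_components V G = V // ({(u, v). {u, v} \<in> G}\<^sup>* \<inter> V \<times> V)"

definition induced_edges :: "'a set set \<Rightarrow> 'a set \<Rightarrow> 'a set set" where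
  "induced_edges E C = {e \<in> E. e \<subseteq> C}"

definition components :: "'a set \<Rightarrow> 'a set set \<Rightarrow> ('a set \<times> 'a set set) set" where
  "components V E = (\<lambda>C. (C, induced_edges E C)) ` graph_components V (two_shadow E)"

definition is_complete_hypergraph :: "nat \<Rightarrow> nat \<Rightarrow> 'a set \<Rightarrow> 'a set set \<Rightarrow> bool" where
  "is_complete_hypergraph r k C F \<longleftrightarrow>
     finite C \<and> card C = k \<and> F = {e. e \<subseteq> C \<and> card e = r}"

end

theory Submission
  imports Defs
begin

text \<open>The proof replaces the hypergraph by a graph with two colours of edges. For a suitable subfamily of
the hyperedges, Hall's theorem produces a graph on \<open>V\<close> with disjoint sets \<open>R\<close> (red) and \<open>B\<close> (blue) of
pairs such that

 \<^item> the pairs have distinct representatives among the hyperedges containing them, so a path in the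
   graph lifts to a Berge path of the same length, and

 \<^item> the number of hyperedges is at most \<open>card R\<close> plus the number of blue \<open>r\<close>-cliques

(lemma \<open>red_blue_representation\<close>). It remains to bound this sum by \<open>card V * c\<close> with
\<open>c = (k choose r) / k\<close> for graphs whose paths have at most \<open>k\<close> vertices (lemma \<open>red_blue_bound\<close>).

For this, one follows the inductive proof of the Erdos-Gallai theorem. A vertex of degree below
\<open>k / 2\<close> is in so few red pairs and blue cliques that its deletion loses less than \<open>c\<close>
(\<open>loss_at_low_degree_vertex\<close>). If all degrees are at least \<open>k / 2\<close>, the vertex set of a longest path
carries a cycle and is therefore a union of components with at most \<open>k\<close> vertices
(\<open>closed_set_of_high_degrees\<close>). On such a small set the bound is a double count
(\<open>red_blue_count_small\<close>): if every blue clique is shared evenly among its pairs, a blue pair receives at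
most \<open>(k choose r) / (k choose 2)\<close>, its share in a complete blue \<open>k\<close>-clique. For
\<open>k \<ge> r + 3\<close> this number exceeds \<open>1\<close>, the
contribution of a red pair.

In the case of equality no vertex is ever deleted, so the graph is a disjoint union of blue
\<open>k\<close>-cliques without red pairs. Then the hyperedges are exactly the blue \<open>r\<close>-cliques, and the
components of the hypergraph are complete on \<open>k\<close> vertices.\<close>

section \<open>Pairs, cliques and paths\<close>

definition pairs :: "'a set \<Rightarrow> 'a set set" where
  "pairs X = {p. p \<subseteq> X \<and> card p = 2}"

text \<open>The cliques are subsets of no prescribed ground set: for \<open>r \<ge> 2\<close> every vertex of a clique lies in
one of its pairs, so the cliques live wherever \<open>B\<close> does (lemma \<open>clique_subset\<close>).\<close>
definition cliques :: "nat \<Rightarrow> 'a set set \<Rightarrow> 'a set set" where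
  "cliques r B = {q. card q = r \<and> pairs q \<subseteq> B}"

definition graph_path :: "'a set \<Rightarrow> 'a set set \<Rightarrow> 'a list \<Rightarrow> bool" where
  "graph_path V G vs \<longleftrightarrow>
     distinct vs \<and> set vs \<subseteq> V \<and> successively (\<lambda>x y. {x, y} \<in> G) vs"

definition neighbours :: "'a set set \<Rightarrow> 'a \<Rightarrow> 'a set" where
  "neighbours G v = {u. {v, u} \<in> G}"

lemma finite_pairs: "finite X \<Longrightarrow> finite (pairs X)"
  unfolding pairs_def by simp

lemma card_pairs: "finite X \<Longrightarrow> card (pairs X) = card X choose 2"
  unfolding pairs_def by (rule n_subsets)

lemma pairs_mono: "X \<subseteq> Y \<Longrightarrow> pairs X \<subseteq> pairs Y"
  unfolding pairs_def by auto

lemma doubleton_in_pairs: "x \<in> X \<Longrightarrow> y \<in> X \<Longrightarrow> x \<noteq> y \<Longrightarrow> {x, y} \<in> pairs X"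
  unfolding pairs_def by auto

lemma edge_no_loop: "G \<subseteq> pairs V \<Longrightarrow> {x, y} \<in> G \<Longrightarrow> x \<noteq> y \<and> x \<in> V \<and> y \<in> V"
  unfolding pairs_def by (cases "x = y") auto

lemma neighbours_subset: "G \<subseteq> pairs V \<Longrightarrow> neighbours G v \<subseteq> V - {v}"
  using edge_no_loop[of G V v] unfolding neighbours_def by blast

lemma clique_subset:
  assumes "B \<subseteq> pairs V" "q \<in> cliques r B" "r \<ge> 2"
  shows "q \<subseteq> V"
proof
  fix x assume "x \<in> q"
  have "card q = r" using assms(2) by (simp add: cliques_def)
  then have "\<not> q \<subseteq> {x}" using assms(3) card_mono[of "{x}" q] by fastforce
  then obtain y where "y \<in> q" "y \<noteq> x" by blast
  then have "{x, y} \<in> B"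
    using \<open>x \<in> q\<close> assms(2) doubleton_in_pairs[of x q y] unfolding cliques_def by blast
  then show "x \<in> V" using edge_no_loop[OF assms(1)] by blast
qed

lemma finite_cliques:
  assumes "finite V" "B \<subseteq> pairs V" "r \<ge> 2"
  shows "finite (cliques r B)"
proof (rule finite_subset)
  show "cliques r B \<subseteq> Pow V" using clique_subset[OF assms(2) _ assms(3)] by blast
qed (use assms(1) in simp)

lemma induced_edges_subset_pairs: "B \<subseteq> pairs V \<Longrightarrow> induced_edges B S \<subseteq> pairs S"
  unfolding induced_edges_def pairs_def by blast

lemma cliques_induced_edges:
  assumes "B \<subseteq> pairs V" "r \<ge> 2"
  shows "cliques r (induced_edges B S) = induced_edges (cliques r B) S"
proof -
  have "q \<subseteq> S" if "q \<in> cliques r (induced_edges B S)" for q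
    using clique_subset[OF induced_edges_subset_pairs[OF assms(1)] that assms(2)] .
  moreover have "pairs q \<subseteq> induced_edges B S \<longleftrightarrow> pairs q \<subseteq> B" if "q \<subseteq> S" for q
    using pairs_mono[OF that] unfolding induced_edges_def pairs_def by blast
  ultimately show ?thesis unfolding cliques_def induced_edges_def[of "{q. P q}" for P] by blast
qed

section \<open>Hall's marriage theorem\<close>

text \<open>The argument of Halmos and Vaughan. If Hall's condition is never tight on a nonempty proper subset,
an arbitrary choice for one element leaves it intact for the others. If it is tight on \<open>X\<close>, then
\<open>X\<close> uses up its whole neighbourhood, and by counting the remaining elements still satisfy the
condition when that neighbourhood is forbidden to them.\<close>
lemma hall:
  fixes N :: "'a \<Rightarrow> 'b set"
  assumes "finite A" "\<And>a. a \<in> A \<Longrightarrow> finite (N a)"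
    and "\<And>X. X \<subseteq> A \<Longrightarrow> card X \<le> card (\<Union>a\<in>X. N a)"
  shows "\<exists>f. inj_on f A \<and> (\<forall>a\<in>A. f a \<in> N a)"
  using assms
proof (induction A arbitrary: N rule: finite_psubset_induct)
  case (psubset A)
  note fin = \<open>\<And>a. a \<in> A \<Longrightarrow> finite (N a)\<close>
  note hall = \<open>\<And>X. X \<subseteq> A \<Longrightarrow> card X \<le> card (\<Union>a\<in>X. N a)\<close>
  have finU: "finite (\<Union>a\<in>X. N a)" if "X \<subseteq> A" for X
    using that fin finite_subset[OF that psubset.hyps] by auto
  consider "A = {}"
    | "A \<noteq> {}" "\<forall>X\<subset>A. X \<noteq> {} \<longrightarrow> card X < card (\<Union>a\<in>X. N a)"
    | X where "X \<subset> A" "X \<noteq> {}" "card X \<ge> card (\<Union>a\<in>X. N a)"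
    by (meson not_less)
  then show ?case
  proof cases
    case 1
    then show ?thesis by simp
  next
    case 2
    then obtain a where a: "a \<in> A" by blast
    have "card (\<Union>b\<in>{a}. N b) \<ge> 1" using hall[of "{a}"] a by simp
    then obtain y where y: "y \<in> N a" by (cases "N a = {}") auto
    have "\<exists>f. inj_on f (A - {a}) \<and> (\<forall>b\<in>A - {a}. f b \<in> N b - {y})"
    proof (rule psubset.IH)
      fix X assume X: "X \<subseteq> A - {a}"
      show "card X \<le> card (\<Union>b\<in>X. N b - {y})"
      proof (cases "X = {}")
        case False
        have "X \<subset> A" using X a by blast
        with False 2 have "card X < card (\<Union>b\<in>X. N b)" by blast
        also have "\<dots> \<le> Suc (card ((\<Union>b\<in>X. N b) - {y}))"
          using card_Suc_Diff1[of "\<Union>b\<in>X. N b" y] finU[of X] \<open>X \<subset> A\<close>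
          by (cases "y \<in> (\<Union>b\<in>X. N b)") auto
        also have "(\<Union>b\<in>X. N b) - {y} = (\<Union>b\<in>X. N b - {y})" by blast
        finally show ?thesis by simp
      qed simp
    qed (use a fin in auto)
    then obtain f where "inj_on f (A - {a})" "\<forall>b\<in>A - {a}. f b \<in> N b - {y}" by blast
    then show ?thesis using y a
      by (intro exI[of _ "f(a := y)"]) (auto simp: inj_on_def)
  next
    case 3
    have XA: "X \<subseteq> A" using 3 by blast
    have "\<exists>f. inj_on f X \<and> (\<forall>b\<in>X. f b \<in> N b)"
      by (rule psubset.IH) (use 3 fin hall in auto)
    then obtain f where f: "inj_on f X" "\<forall>b\<in>X. f b \<in> N b" by blast
    define M where "M = (\<Union>a\<in>X. N a)"
    have finM: "finite M" unfolding M_def using finU[OF XA] .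
    have "\<exists>g. inj_on g (A - X) \<and> (\<forall>b\<in>A - X. g b \<in> N b - M)"
    proof (rule psubset.IH)
      fix Y assume Y: "Y \<subseteq> A - X"
      have finX: "finite X" "finite Y" using XA Y psubset(1) finite_subset by blast+
      have finNY: "finite (\<Union>b\<in>Y. N b - M)"
        using finU[of Y] Y by (auto intro: finite_subset[of _ "\<Union>b\<in>Y. N b"])
      have "card Y + card X = card (Y \<union> X)"
        using Y finX by (subst card_Un_disjoint) auto
      also have "\<dots> \<le> card (\<Union>b\<in>Y \<union> X. N b)" using hall[of "Y \<union> X"] Y XA by auto
      also have "(\<Union>b\<in>Y \<union> X. N b) = (\<Union>b\<in>Y. N b - M) \<union> M" unfolding M_def by blast
      also have "card \<dots> = card (\<Union>b\<in>Y. N b - M) + card M"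
        using finNY finM by (subst card_Un_disjoint) auto
      finally show "card Y \<le> card (\<Union>b\<in>Y. N b - M)" using 3 unfolding M_def by simp
    qed (use 3 fin in auto)
    then obtain g where g: "inj_on g (A - X)" "\<forall>b\<in>A - X. g b \<in> N b - M" by blast
    have fM: "\<forall>b\<in>X. f b \<in> M" using f(2) unfolding M_def by blast
    show ?thesis
    proof (intro exI conjI ballI)
      show "inj_on (\<lambda>b. if b \<in> X then f b else g b) A"
      proof (rule inj_onI)
        fix a b
        assume "a \<in> A" "b \<in> A" "(if a \<in> X then f a else g a) = (if b \<in> X then f b else g b)"
        then show "a = b"
          using f(1) g fM by (cases "a \<in> X"; cases "b \<in> X") (force dest: inj_onD)+
      qed
    qed (use f g in auto)
  qed
qed

section \<open>Binomial estimates\<close>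

text \<open>Of the \<open>s\<close>-subsets of a \<open>2x\<close>-set that is cut into \<open>x\<close> couples, those with at most one element from each
couple alone number \<open>2 ^ s * (x choose s)\<close>. This gains a factor \<open>2 ^ s\<close> for a vertex whose degree is
less than half of \<open>k\<close>.\<close>
lemma two_pow_choose_le: "2 ^ s * (x choose s) \<le> (2 * x choose s)"
proof (induction s arbitrary: x)
  case (Suc s)
  show ?case
  proof (cases x)
    case (Suc y)
    have "Suc s * (2 ^ Suc s * (Suc y choose Suc s)) = 2 * 2 ^ s * (Suc s * (Suc y choose Suc s))"
      by (simp only: power_Suc mult_ac)
    also have "\<dots> = 2 * Suc y * (2 ^ s * (y choose s))"
      unfolding Suc_times_binomial by (simp add: algebra_simps)
    also have "\<dots> \<le> 2 * Suc y * (Suc (2 * y) choose s)"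
      using Suc.IH[of y] binomial_right_mono[of "2 * y" "Suc (2 * y)" s]
      by (intro mult_left_mono) linarith+
    also have "\<dots> = Suc (Suc (2 * y)) * (Suc (2 * y) choose s)" by simp
    also have "\<dots> = Suc s * (2 * Suc y choose Suc s)"
      unfolding Suc_times_binomial[symmetric] by simp
    finally show ?thesis unfolding Suc by (simp only: Suc_mult_le_cancel1)
  qed simp
qed simp

lemma less_two_pow_pred: "r \<ge> 3 \<Longrightarrow> r < 2 ^ (r - 1)" for r :: nat
proof (induction r rule: dec_induct)
  case (step n)
  then obtain m where "n = Suc m" by (cases n) auto
  then show ?case using step by simp
qed simp

text \<open>The number of \<open>r\<close>-subsets per pair in a \<open>k\<close>-set, that is \<open>(k choose r) / (k choose 2)\<close> (see
\<open>density_pairs\<close>). The form chosen here is the one double counting produces: a pair lies in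
\<open>k - 2 choose (r - 2)\<close> of the \<open>r\<close>-sets, and an \<open>r\<close>-set contains \<open>r choose 2\<close> pairs.\<close>
definition density :: "nat \<Rightarrow> nat \<Rightarrow> real" where
  "density r k = real (k - 2 choose (r - 2)) / real (r choose 2)"

text \<open>This is where \<open>k \<ge> r + 3\<close> enters: already
\<open>r + 1 choose (r - 2) = r + 1 choose 3\<close> exceeds \<open>r choose 2\<close>. The strict inequality
makes a blue pair worth more than a red one, so that no red pair survives in the extremal case.\<close>
lemma density_gt_1:
  assumes "r \<ge> 3" "k \<ge> r + 3"
  shows "density r k > 1"
proof -
  have "3 * (r + 1 choose 3) = (r + 1) * (r choose 2)"
    using Suc_times_binomial[of 2 r] by (simp add: numeral_3_eq_3 eval_nat_numeral)
  moreover have "r choose 2 > 0" using assms by simp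
  ultimately have "3 * (r + 1 choose 3) > 3 * (r choose 2)" using assms by simp
  then have "r choose 2 < r + 1 choose 3" by simp
  also have "\<dots> = r + 1 choose (r - 2)"
    using binomial_symmetric[of 3 "r + 1"] assms by simp
  also have "\<dots> \<le> k - 2 choose (r - 2)" using assms by (intro binomial_right_mono) simp
  finally show ?thesis unfolding density_def using \<open>r choose 2 > 0\<close> by simp
qed

text \<open>The target weight \<open>(k choose r) / k\<close> per vertex is what \<open>density r k\<close> per pair gives when
every vertex lies in \<open>k - 1\<close> pairs, each pair shared between two vertices.\<close>
lemma density_pairs:
  assumes "r \<ge> 2" "k \<ge> r"
  shows "density r k * (real k - 1) / 2 = real (k choose r) / real k"
proof -
  have "(k choose r) * (r choose 2) = (k choose 2) * (k - 2 choose (r - 2))"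
    using choose_mult[of 2 r k] assms by simp
  then have "real (k choose r) * real (r choose 2) = real (k choose 2) * real (k - 2 choose (r - 2))"
    by (metis of_nat_mult)
  moreover have "real (k choose 2) = real k * (real k - 1) / 2"
    using assms by (simp add: choose_two real_of_nat_div of_nat_diff)
  moreover have "real (r choose 2) > 0" using assms by simp
  ultimately show ?thesis unfolding density_def using assms
    by (simp add: field_simps)
qed

section \<open>Counting red pairs and blue cliques\<close>

lemma card_supersets_le:
  assumes "finite S" "finite p" "p \<subseteq> S"
  shows "card {q. q \<subseteq> S \<and> p \<subseteq> q \<and> card q = r} \<le> card S - card p choose (r - card p)"
proof -
  let ?Q = "{q. q \<subseteq> S \<and> p \<subseteq> q \<and> card q = r}"
  have "inj_on (\<lambda>q. q - p) ?Q" by (rule inj_onI) blast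
  moreover have "(\<lambda>q. q - p) ` ?Q \<subseteq> {s. s \<subseteq> S - p \<and> card s = r - card p}"
    using assms(2) by (auto simp: card_Diff_subset)
  ultimately have "card ?Q \<le> card {s. s \<subseteq> S - p \<and> card s = r - card p}"
    using assms(1) by (intro card_inj_on_le) auto
  also have "\<dots> = card S - card p choose (r - card p)"
    using n_subsets[of "S - p"] assms by (simp add: card_Diff_subset)
  finally show ?thesis .
qed

text \<open>Double counting of the incidences between the pairs in \<open>B\<close> and the cliques containing them.\<close>
lemma card_cliques_le:
  assumes "finite S" "card S \<le> k" "B \<subseteq> pairs S" "r \<ge> 2"
  shows "real (card (cliques r B)) \<le> density r k * real (card B)"
proof -
  have finB: "finite B" using finite_subset[OF assms(3) finite_pairs[OF assms(1)]] .
  have finQ: "finite (cliques r B)" using finite_cliques[OF assms(1,3,4)] .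
  have "{p \<in> B. p \<subseteq> q} = pairs q" if "q \<in> cliques r B" for q
    using that assms(3) unfolding cliques_def pairs_def by blast
  moreover have "card (pairs q) = r choose 2" if "q \<in> cliques r B" for q
    using that assms(4) by (subst card_pairs) (auto simp: cliques_def intro: card_ge_0_finite)
  ultimately have "(\<Sum>q\<in>cliques r B. card {p \<in> B. p \<subseteq> q}) = (r choose 2) * card (cliques r B)"
    by simp
  moreover have "(\<Sum>q\<in>cliques r B. card {p \<in> B. p \<subseteq> q})
      = (\<Sum>p\<in>B. card {q \<in> cliques r B. p \<subseteq> q})"
    using finB finQ by (intro sum_multicount_gen) auto
  moreover have "\<dots> \<le> (\<Sum>p\<in>B. k - 2 choose (r - 2))"
  proof (rule sum_mono)
    fix p assume "p \<in> B"
    then have p: "p \<subseteq> S" "card p = 2" using assms(3) by (auto simp: pairs_def)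
    have "finite p" using p(1) assms(1) finite_subset by blast
    have "card {q \<in> cliques r B. p \<subseteq> q} \<le> card {q. q \<subseteq> S \<and> p \<subseteq> q \<and> card q = r}"
    proof (rule card_mono)
      show "{q \<in> cliques r B. p \<subseteq> q} \<subseteq> {q. q \<subseteq> S \<and> p \<subseteq> q \<and> card q = r}"
        using clique_subset[OF assms(3) _ assms(4)] unfolding cliques_def by blast
    qed (use assms(1) in simp)
    also have "\<dots> \<le> card S - 2 choose (r - 2)"
      using card_supersets_le[OF assms(1) \<open>finite p\<close> p(1), of r] p(2) by simp
    also have "\<dots> \<le> k - 2 choose (r - 2)" using assms(2) by (intro binomial_right_mono) simp
    finally show "card {q \<in> cliques r B. p \<subseteq> q} \<le> k - 2 choose (r - 2)" .
  qed
  ultimately have "(r choose 2) * card (cliques r B) \<le> card B * (k - 2 choose (r - 2))"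
    by simp
  then have "real (r choose 2) * real (card (cliques r B))
      \<le> real (card B) * real (k - 2 choose (r - 2))"
    by (metis of_nat_le_iff of_nat_mult)
  moreover have "real (r choose 2) > 0" using assms(4) by simp
  ultimately show ?thesis unfolding density_def by (simp add: field_simps)
qed

text \<open>A red pair counts \<open>1\<close>, and a blue pair counts at most \<open>density r k > 1\<close> when the cliques are
distributed over their pairs. The total is therefore at most
\<open>density r k * (card S choose 2)\<close>, and each vertex has at most \<open>k - 1\<close> partners. Equality forces
all of these estimates to be sharp.\<close>
lemma red_blue_count_small:
  assumes "r \<ge> 3" "k \<ge> r + 3"
    and S: "finite S" "S \<noteq> {}" "card S \<le> k"
    and RB: "R \<subseteq> pairs S" "B \<subseteq> pairs S" "R \<inter> B = {}"
  shows "real (card R) + real (card (cliques r B)) \<le> real (card S) * (real (k choose r) / real k)"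
    and "real (card R) + real (card (cliques r B)) = real (card S) * (real (k choose r) / real k)
      \<Longrightarrow> card S = k \<and> B = pairs S"
proof -
  let ?\<rho> = "density r k" and ?m = "real (card S)"
  have \<rho>: "?\<rho> > 1" using density_gt_1 assms(1,2) .
  have m: "?m > 0" using S by (simp add: card_gt_0_iff)
  have fin: "finite R" "finite B"
    using finite_subset[OF _ finite_pairs[OF S(1)]] RB by auto
  have Q: "real (card (cliques r B)) \<le> ?\<rho> * real (card B)"
    using card_cliques_le[OF S(1,3) RB(2)] assms(1) by simp
  have "card R + card B = card (R \<union> B)" using fin RB(3) by (simp add: card_Un_disjoint)
  also have "\<dots> \<le> card (pairs S)" using RB by (intro card_mono finite_pairs S) auto
  finally have le: "card R + card B \<le> card (pairs S)" .
  have P: "real (card (pairs S)) = ?m * (?m - 1) / 2"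
    using S by (simp add: card_pairs choose_two real_of_nat_div of_nat_diff card_gt_0_iff Suc_le_eq)
  have "?\<rho> * ((real k - 1) / 2) = real (k choose r) / real k"
    using density_pairs[of r k] assms(1,2) by simp
  then have c: "?m * (real (k choose r) / real k) = ?m * (?\<rho> * ((real k - 1) / 2))" by simp
  have 1: "real (card R) + ?\<rho> * real (card B) \<le> ?\<rho> * (real (card R) + real (card B))"
    using \<rho> mult_right_mono[of 1 ?\<rho> "real (card R)"] by (simp add: distrib_left)
  have 2: "?\<rho> * (real (card R) + real (card B)) \<le> ?\<rho> * real (card (pairs S))"
    using \<rho> le by (intro mult_left_mono) auto
  have 3: "?\<rho> * real (card (pairs S)) \<le> ?m * (?\<rho> * ((real k - 1) / 2))"
    unfolding P using \<rho> m S(3) by (simp add: mult_left_mono)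
  show "real (card R) + real (card (cliques r B)) \<le> ?m * (real (k choose r) / real k)"
    using Q 1 2 3 c by linarith
  assume eq: "real (card R) + real (card (cliques r B)) = ?m * (real (k choose r) / real k)"
  have e1: "real (card R) + ?\<rho> * real (card B) = ?\<rho> * (real (card R) + real (card B))"
    and e2: "?\<rho> * (real (card R) + real (card B)) = ?\<rho> * real (card (pairs S))"
    and e3: "?\<rho> * real (card (pairs S)) = ?m * (?\<rho> * ((real k - 1) / 2))"
    using Q 1 2 3 c eq by linarith+
  have "card S = k" using e3[unfolded P] \<rho> m by simp
  moreover have "card R = 0" using e1 \<rho> by (simp add: distrib_left)
  moreover have "real (card R + card B) = real (card (pairs S))" using e2 \<rho> by simp
  ultimately have "card S = k" "card B = card (pairs S)" by linarith+
  then show "card S = k \<and> B = pairs S"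
    using card_subset_eq[OF finite_pairs[OF S(1)] RB(2)] by simp
qed

text \<open>Here \<open>a\<close> and \<open>b\<close> stand for the red and the blue degree of a vertex of total degree below \<open>k / 2\<close>.
Writing \<open>b choose (r - 1) = b / (r - 1) * (b - 1 choose (r - 2))\<close>, a blue neighbour contributes less
than \<open>density r k\<close>: halving the ground set costs the factor \<open>2 ^ (r - 2)\<close>, and \<open>r < 2 ^ (r - 1)\<close>.
A red neighbour contributes \<open>1\<close>, which is less as well. Hence each of at most \<open>(k - 1) / 2\<close>
neighbours falls short of its share of \<open>density r k * (k - 1) / 2 = (k choose r) / k\<close>.\<close>
lemma low_degree_count_less:
  assumes "r \<ge> 3" "k \<ge> r + 3" "2 * (a + b) < k"
  shows "real a + real (b choose (r - 1)) < real (k choose r) / real k"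
proof -
  let ?\<rho> = "density r k"
  have \<rho>: "?\<rho> > 1" using density_gt_1 assms(1,2) .
  define s where "s = r - 2"
  have s: "r = Suc (Suc s)" unfolding s_def using assms(1) by simp
  have c: "real (k choose r) / real k = ?\<rho> * ((real k - 1) / 2)"
    using density_pairs[of r k] assms(1,2) by simp
  have b: "real (b choose (r - 1)) < ?\<rho> * real b" if "b > 0"
  proof -
    obtain x where Suc: "b = Suc x" using \<open>b > 0\<close> gr0_implies_Suc by blast
    have "r * (x choose s) < 2 * (k - 2 choose s)"
    proof (cases "x choose s = 0")
      case True
      have "k - 2 choose s > 0" using assms(2) s by simp
      then show ?thesis unfolding True by simp
    next
      case False
      then have "r * (x choose s) < 2 ^ (r - 1) * (x choose s)"
        using less_two_pow_pred[OF assms(1)] by simp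
      also have "\<dots> = 2 * (2 ^ s * (x choose s))" using s by simp
      also have "\<dots> \<le> 2 * (2 * x choose s)" using two_pow_choose_le[of s x] by simp
      also have "\<dots> \<le> 2 * (k - 2 choose s)"
        using assms(3) Suc by (intro mult_left_mono binomial_right_mono) auto
      finally show ?thesis .
    qed
    then have less: "real r * real (x choose s) < 2 * real (k - 2 choose s)"
      by (metis of_nat_less_iff of_nat_mult of_nat_numeral)
    have "Suc s * (Suc x choose Suc s) = Suc x * (x choose s)" by (rule Suc_times_binomial)
    moreover have "r - 1 = Suc s" using s by simp
    ultimately have eq: "real (Suc s) * real (b choose (r - 1)) = real b * real (x choose s)"
      unfolding Suc by (metis of_nat_mult)
    have d: "?\<rho> = 2 * real (k - 2 choose s) / (real r * real (Suc s))"
    proof -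
      have h: "real (r choose 2) = real r * real (Suc s) / 2"
        using s by (simp add: choose_two real_of_nat_div field_simps)
      show ?thesis unfolding density_def h using s by (simp del: of_nat_Suc)
    qed
    have "real r * real (Suc s) * real (b choose (r - 1)) = real b * (real r * real (x choose s))"
      using eq by (simp add: mult_ac)
    also have "\<dots> < real b * (2 * real (k - 2 choose s))"
      using less that by (intro mult_strict_left_mono) auto
    finally have "real (b choose (r - 1)) * (real r * real (Suc s))
        < 2 * real (k - 2 choose s) * real b" by (simp only: mult_ac)
    moreover have "real r * real (Suc s) > 0" using s by simp
    ultimately show ?thesis unfolding d times_divide_eq_left
      by (subst pos_less_divide_eq)
  qed
  show ?thesis
  proof (cases "a + b = 0")
    case True
    then show ?thesis using s assms by simp
  next
    case False
    have b0: "real (b choose (r - 1)) \<le> ?\<rho> * real b" using b s by (cases "b = 0") auto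
    have a: "real a < ?\<rho> * real a" if "a > 0"
      using \<rho> that mult_strict_right_mono[of 1 ?\<rho> "real a"] by simp
    have "real a + real (b choose (r - 1)) < ?\<rho> * real a + ?\<rho> * real b"
    proof (cases "a = 0")
      case True
      then show ?thesis using b False by simp
    next
      case False
      then show ?thesis using a b0 by (intro add_less_le_mono) auto
    qed
    also have "\<dots> = ?\<rho> * (real a + real b)" by (simp only: distrib_left)
    also have "\<dots> \<le> ?\<rho> * ((real k - 1) / 2)"
      using assms(3) \<rho> by (intro mult_left_mono) auto
    finally show ?thesis unfolding c .
  qed
qed

lemma card_edges_at_le:
  assumes "finite V" "R \<subseteq> pairs V"
  shows "card {p \<in> R. v \<in> p} \<le> card (neighbours R v)"
proof -
  have fin: "finite (neighbours R v)"
    using neighbours_subset[OF assms(2)] assms(1) finite_subset by blast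
  have "{p \<in> R. v \<in> p} \<subseteq> (\<lambda>u. {v, u}) ` neighbours R v"
  proof
    fix p assume p: "p \<in> {p \<in> R. v \<in> p}"
    then have "card p = 2" using assms(2) by (auto simp: pairs_def)
    then obtain u where "p = {v, u}" using p by (auto simp: card_2_iff doubleton_eq_iff)
    then show "p \<in> (\<lambda>u. {v, u}) ` neighbours R v" using p by (auto simp: neighbours_def)
  qed
  then show ?thesis using fin card_mono card_image_le by (meson finite_imageI le_trans)
qed

lemma card_cliques_at_le:
  assumes "finite V" "B \<subseteq> pairs V" "r \<ge> 2"
  shows "card {q \<in> cliques r B. v \<in> q} \<le> card (neighbours B v) choose (r - 1)"
proof -
  have fin: "finite (neighbours B v)"
    using neighbours_subset[OF assms(2)] assms(1) finite_subset by blast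
  have "inj_on (\<lambda>q. q - {v}) {q \<in> cliques r B. v \<in> q}" by (rule inj_onI) blast
  moreover have "(\<lambda>q. q - {v}) ` {q \<in> cliques r B. v \<in> q}
      \<subseteq> {s. s \<subseteq> neighbours B v \<and> card s = r - 1}"
  proof
    fix s assume "s \<in> (\<lambda>q. q - {v}) ` {q \<in> cliques r B. v \<in> q}"
    then obtain q where q: "s = q - {v}" "v \<in> q" "card q = r" "pairs q \<subseteq> B"
      by (auto simp: cliques_def)
    have "{v, u} \<in> B" if "u \<in> s" for u
      using that q doubleton_in_pairs[of v q u] by blast
    then show "s \<in> {s. s \<subseteq> neighbours B v \<and> card s = r - 1}"
      using q by (auto simp: neighbours_def)
  qed
  ultimately have "card {q \<in> cliques r B. v \<in> q}
      \<le> card {s. s \<subseteq> neighbours B v \<and> card s = r - 1}"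
    using fin by (intro card_inj_on_le) auto
  then show ?thesis using n_subsets[OF fin] by simp
qed

text \<open>Deleting a vertex of degree below \<open>k / 2\<close> thus loses strictly less than the average that the bound
allows per vertex.\<close>
lemma loss_at_low_degree_vertex:
  assumes "r \<ge> 3" "k \<ge> r + 3"
    and "finite V" "R \<subseteq> pairs V" "B \<subseteq> pairs V" "R \<inter> B = {}"
    and "2 * card (neighbours (R \<union> B) v) < k"
  shows "real (card {p \<in> R. v \<in> p}) + real (card {q \<in> cliques r B. v \<in> q})
      < real (k choose r) / real k"
proof -
  have fin: "finite (neighbours R v)" "finite (neighbours B v)"
    using finite_subset[OF neighbours_subset[OF assms(4)]]
      finite_subset[OF neighbours_subset[OF assms(5)]] assms(3) by auto
  have "neighbours (R \<union> B) v = neighbours R v \<union> neighbours B v"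
    "neighbours R v \<inter> neighbours B v = {}"
    using assms(6) unfolding neighbours_def by blast+
  then have "card (neighbours (R \<union> B) v) = card (neighbours R v) + card (neighbours B v)"
    using fin by (simp add: card_Un_disjoint)
  then have "real (card (neighbours R v)) + real (card (neighbours B v) choose (r - 1))
      < real (k choose r) / real k"
    using low_degree_count_less[OF assms(1,2)] assms(7) by simp
  moreover have "real (card {p \<in> R. v \<in> p}) \<le> real (card (neighbours R v))"
    using card_edges_at_le[OF assms(3,4)] by simp
  moreover have "real (card {q \<in> cliques r B. v \<in> q})
      \<le> real (card (neighbours B v) choose (r - 1))"
    using card_cliques_at_le[OF assms(3,5)] assms(1) by simp
  ultimately show ?thesis by linarith
qed

section \<open>Longest paths in graphs of large minimum degree\<close>

lemma exists_longest_path: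
  assumes "finite V" "v \<in> V"
  obtains vs where "graph_path V G vs" "vs \<noteq> []"
    "\<And>ws. graph_path V G ws \<Longrightarrow> length ws \<le> length vs"
proof -
  have "length ws < Suc (card V)" if "graph_path V G ws" for ws
    using that assms(1) card_mono[of V "set ws"]
    by (simp add: graph_path_def distinct_card less_Suc_eq_le)
  moreover have v: "graph_path V G [v]" using assms(2) by (simp add: graph_path_def)
  ultimately obtain vs where vs: "graph_path V G vs"
    "\<And>ws. graph_path V G ws \<Longrightarrow> length ws \<le> length vs"
    using ex_has_greatest_nat[of "graph_path V G" "[v]" length "Suc (card V)"] by blast
  moreover have "vs \<noteq> []" using vs(2)[OF v] by auto
  ultimately show ?thesis using that by blast
qed

lemma path_rev: "graph_path V G vs \<Longrightarrow> graph_path V G (rev vs)"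
  unfolding graph_path_def by (simp add: insert_commute)

lemma path_Cons:
  "graph_path V G vs \<Longrightarrow> vs \<noteq> [] \<Longrightarrow> {u, hd vs} \<in> G \<Longrightarrow> u \<in> V \<Longrightarrow> u \<notin> set vs \<Longrightarrow>
    graph_path V G (u # vs)"
  unfolding graph_path_def by (simp add: successively_Cons)

lemma longest_path_end_neighbours:
  assumes "G \<subseteq> pairs V" "graph_path V G vs" "vs \<noteq> []"
    and "\<And>ws. graph_path V G ws \<Longrightarrow> length ws \<le> length vs"
  shows "neighbours G (hd vs) \<subseteq> set vs" "neighbours G (last vs) \<subseteq> set vs"
proof -
  (* the two ends are exchanged by reversal, so it suffices to treat the first vertex *)
  have *: "neighbours G (hd ws) \<subseteq> set ws"
    if "graph_path V G ws" "ws \<noteq> []" "length ws = length vs" for ws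
  proof
    fix u assume "u \<in> neighbours G (hd ws)"
    then have u: "{u, hd ws} \<in> G" by (simp add: neighbours_def insert_commute)
    show "u \<in> set ws"
    proof (rule ccontr)
      assume "u \<notin> set ws"
      then have "graph_path V G (u # ws)"
        using path_Cons[OF that(1,2) u] edge_no_loop[OF assms(1) u] by blast
      then show False using assms(4)[of "u # ws"] that(3) by simp
    qed
  qed
  show "neighbours G (hd vs) \<subseteq> set vs" using *[of vs] assms by simp
  show "neighbours G (last vs) \<subseteq> set vs"
    using *[OF path_rev[OF assms(2)]] assms(3) by (simp add: hd_rev)
qed

text \<open>Ore's pigeonhole argument: the indices \<open>i\<close> for which the first vertex is adjacent to \<open>vs ! Suc i\<close>, and
those for which the last vertex is adjacent to \<open>vs ! i\<close>, are together at least \<open>length vs\<close> many, but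
only \<open>length vs - 1\<close> indices are available.\<close>
lemma crossing_chords:
  assumes "G \<subseteq> pairs V" "graph_path V G vs" "vs \<noteq> []"
    and "neighbours G (hd vs) \<subseteq> set vs" "neighbours G (last vs) \<subseteq> set vs"
    and "card (neighbours G (hd vs)) + card (neighbours G (last vs)) \<ge> length vs"
  obtains i where "Suc i < length vs" "{hd vs, vs ! Suc i} \<in> G" "{vs ! i, last vs} \<in> G"
proof -
  define t where "t = length vs - 1"
  have t: "length vs = Suc t" using assms(3) by (simp add: t_def)
  have ends: "hd vs = vs ! 0" "last vs = vs ! t"
    using assms(3) by (simp_all add: hd_conv_nth last_conv_nth t_def)
  define I where "I = {i. i < t \<and> {hd vs, vs ! Suc i} \<in> G}"
  define J where "J = {i. i < t \<and> {vs ! i, last vs} \<in> G}"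
  have fin: "finite I" "finite J" by (simp_all add: I_def J_def)
  have "neighbours G (hd vs) \<subseteq> (\<lambda>i. vs ! Suc i) ` I"
  proof
    fix u assume u: "u \<in> neighbours G (hd vs)"
    then obtain j where j: "j < length vs" "u = vs ! j" using assms(4) by (metis in_set_conv_nth subsetD)
    have "hd vs \<noteq> u" using u edge_no_loop[OF assms(1)] by (auto simp: neighbours_def)
    then obtain i where "j = Suc i" using j ends by (cases j) auto
    then show "u \<in> (\<lambda>i. vs ! Suc i) ` I" using j u t by (auto simp: I_def neighbours_def)
  qed
  then have "card (neighbours G (hd vs)) \<le> card I"
    using fin by (meson card_image_le card_mono finite_imageI le_trans)
  moreover have "neighbours G (last vs) \<subseteq> (\<lambda>i. vs ! i) ` J"
  proof
    fix u assume u: "u \<in> neighbours G (last vs)"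
    then obtain j where j: "j < length vs" "u = vs ! j" using assms(5) by (metis in_set_conv_nth subsetD)
    have "last vs \<noteq> u" using u edge_no_loop[OF assms(1)] by (auto simp: neighbours_def)
    then have "j \<noteq> t" using j ends by auto
    then show "u \<in> (\<lambda>i. vs ! i) ` J"
      using j u t by (auto simp: J_def neighbours_def insert_commute)
  qed
  then have "card (neighbours G (last vs)) \<le> card J"
    using fin by (meson card_image_le card_mono finite_imageI le_trans)
  ultimately have "card I + card J > t" using assms(6) t by linarith
  moreover have "card (I \<union> J) \<le> card {..<t}" by (rule card_mono) (auto simp: I_def J_def)
  ultimately have "I \<inter> J \<noteq> {}" using fin by (auto simp: card_Un_disjoint)
  then obtain i where "i \<in> I" "i \<in> J" by blast
  then show ?thesis using that[of i] t by (simp add: I_def J_def)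
qed

text \<open>Crossing chords close the path into a cycle: run to \<open>vs ! i\<close>, jump to the last vertex, run backwards
to \<open>vs ! Suc i\<close> and return to the first vertex. The cycle is represented by a path \<open>cs\<close> with adjacent
ends.\<close>
lemma spanning_cycle_of_crossing:
  assumes "graph_path V G vs" "Suc i < length vs"
    and "{hd vs, vs ! Suc i} \<in> G" "{vs ! i, last vs} \<in> G"
  obtains cs where "graph_path V G cs" "set cs = set vs" "length cs = length vs"
    "{last cs, hd cs} \<in> G"
proof -
  define xs ys where "xs = take (Suc i) vs" and "ys = drop (Suc i) vs"
  have vs: "vs = xs @ ys" by (simp add: xs_def ys_def)
  have ne: "xs \<noteq> []" "ys \<noteq> []" using assms(2) by (auto simp: xs_def ys_def)
  have "hd ys = vs ! Suc i" unfolding ys_def using assms(2) by (rule hd_drop_conv_nth)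
  moreover have "last xs = vs ! i" unfolding xs_def
    using assms(2) by (simp add: take_Suc_conv_app_nth)
  moreover have "hd vs = hd xs" "last vs = last ys" using ne by (simp_all add: vs)
  ultimately have ch: "{hd ys, hd xs} \<in> G" "{last xs, last ys} \<in> G"
    using assms(3,4) by (simp_all add: insert_commute)
  have sym: "successively (\<lambda>x y. {y, x} \<in> G) ys \<longleftrightarrow> successively (\<lambda>x y. {x, y} \<in> G) ys"
    by (rule successively_cong) (auto simp: insert_commute)
  have "graph_path V G (xs @ rev ys)"
    using assms(1) ch ne unfolding vs graph_path_def
    by (auto simp: successively_append_iff hd_rev sym)
  moreover have "{last (xs @ rev ys), hd (xs @ rev ys)} \<in> G"
    using ne ch by (simp add: last_rev)
  ultimately show ?thesis using that[of "xs @ rev ys"] by (simp add: vs)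
qed

lemma cycle_rotate:
  assumes "graph_path V G cs" "{last cs, hd cs} \<in> G" "y \<in> set cs"
  obtains ws where "graph_path V G ws" "hd ws = y" "set ws = set cs" "length ws = length cs" "ws \<noteq> []"
proof -
  obtain as bs where cs: "cs = as @ y # bs" using split_list[OF assms(3)] by blast
  have "graph_path V G (y # bs @ as)"
    using assms(1,2) unfolding cs graph_path_def
    by (auto simp: successively_append_iff successively_Cons hd_append split: if_splits)
  then show ?thesis using that[of "y # bs @ as"] by (auto simp: cs)
qed

text \<open>A longest path closes into a cycle on the same vertex set. No edge leaves this set, since the cycle
can be cut open at the end point of such an edge and prolonged by it. So the vertices of a
longest path form a union of components, of size at most \<open>k\<close>.\<close>
lemma closed_set_of_high_degrees:
  assumes "finite V" "G \<subseteq> pairs V" "V \<noteq> {}"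
    and "\<And>vs. graph_path V G vs \<Longrightarrow> length vs \<le> k"
    and "\<And>v. v \<in> V \<Longrightarrow> 2 * card (neighbours G v) \<ge> k"
  obtains S where "S \<subseteq> V" "S \<noteq> {}" "card S \<le> k" "\<And>p. p \<in> G \<Longrightarrow> p \<subseteq> S \<or> p \<subseteq> V - S"
proof -
  obtain v where "v \<in> V" using assms(3) by blast
  then obtain vs where vs: "graph_path V G vs" "vs \<noteq> []"
    and longest: "\<And>ws. graph_path V G ws \<Longrightarrow> length ws \<le> length vs"
    using exists_longest_path[OF assms(1)] by metis
  have ends: "hd vs \<in> V" "last vs \<in> V" using vs by (auto simp: graph_path_def)
  note nb = longest_path_end_neighbours[OF assms(2) vs longest]
  have "card (neighbours G (hd vs)) + card (neighbours G (last vs)) \<ge> length vs"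
    using assms(4)[OF vs(1)] assms(5)[OF ends(1)] assms(5)[OF ends(2)] by linarith
  then obtain i where "Suc i < length vs" "{hd vs, vs ! Suc i} \<in> G" "{vs ! i, last vs} \<in> G"
    using crossing_chords[OF assms(2) vs nb] by blast
  then obtain cs where cs: "graph_path V G cs" "set cs = set vs" "length cs = length vs"
    "{last cs, hd cs} \<in> G"
    using spanning_cycle_of_crossing[OF vs(1)] by blast
  (* an edge from u to the cycle would give a path longer than vs *)
  have leave: "u \<in> set vs" if "y \<in> set vs" "{u, y} \<in> G" for u y
  proof (rule ccontr)
    assume u: "u \<notin> set vs"
    have "y \<in> set cs" using that(1) cs(2) by simp
    then obtain ws where ws: "graph_path V G ws" "hd ws = y" "set ws = set cs"
      "length ws = length cs" "ws \<noteq> []"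
      by (rule cycle_rotate[OF cs(1,4)])
    have "graph_path V G (u # ws)"
      using path_Cons[OF ws(1,5)] ws(2,3) cs(2) u that(2) edge_no_loop[OF assms(2) that(2)] by simp
    then show False using longest[of "u # ws"] ws(4) cs(3) by simp
  qed
  have "p \<subseteq> set vs \<or> p \<subseteq> V - set vs" if "p \<in> G" for p
  proof -
    have "card p = 2" "p \<subseteq> V" using that assms(2) by (auto simp: pairs_def)
    then obtain x y where "p = {x, y}" by (auto simp: card_2_iff)
    then show ?thesis using leave[of x y] leave[of y x] that \<open>p \<subseteq> V\<close>
      by (auto simp: insert_commute)
  qed
  moreover have "card (set vs) \<le> k" using assms(4)[OF vs(1)] vs(1)
    by (simp add: graph_path_def distinct_card)
  ultimately show ?thesis using that[of "set vs"] vs by (auto simp: graph_path_def)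
qed

section \<open>The bound for red-blue graphs\<close>

lemma card_delete_vertex:
  assumes "finite F" "\<And>p. p \<in> F \<Longrightarrow> p \<subseteq> V"
  shows "card F = card (induced_edges F (V - {v})) + card {p \<in> F. v \<in> p}"
proof -
  have "F = induced_edges F (V - {v}) \<union> {p \<in> F. v \<in> p}"
    using assms(2) by (auto simp: induced_edges_def)
  moreover have "card (induced_edges F (V - {v}) \<union> {p \<in> F. v \<in> p})
      = card (induced_edges F (V - {v})) + card {p \<in> F. v \<in> p}"
    using assms(1) by (intro card_Un_disjoint) (auto simp: induced_edges_def)
  ultimately show ?thesis by simp
qed

lemma card_split:
  assumes "finite F" "{} \<notin> F" "\<And>p. p \<in> F \<Longrightarrow> p \<subseteq> S \<or> p \<subseteq> V - S"
  shows "card F = card (induced_edges F S) + card (induced_edges F (V - S))"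
proof -
  have "F = induced_edges F S \<union> induced_edges F (V - S)"
    using assms(3) by (auto simp: induced_edges_def)
  moreover have "induced_edges F S \<inter> induced_edges F (V - S) = {}"
  proof (rule equals0I)
    fix p assume "p \<in> induced_edges F S \<inter> induced_edges F (V - S)"
    then have "p \<in> F" "p \<subseteq> {}" unfolding induced_edges_def by blast+
    then show False using assms(2) by simp
  qed
  then have "card (induced_edges F S \<union> induced_edges F (V - S))
      = card (induced_edges F S) + card (induced_edges F (V - S))"
    using assms(1) by (intro card_Un_disjoint) (auto simp: induced_edges_def)
  ultimately show ?thesis by simp
qed

lemma clique_in_closed_set:
  assumes "B \<subseteq> pairs V" "r \<ge> 2" "\<And>p. p \<in> B \<Longrightarrow> p \<subseteq> S \<or> p \<subseteq> V - S" "q \<in> cliques r B"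
  shows "q \<subseteq> S \<or> q \<subseteq> V - S"
proof (rule disjCI)
  assume "\<not> q \<subseteq> V - S"
  moreover have "q \<subseteq> V" using clique_subset[OF assms(1,4,2)] .
  ultimately obtain x where x: "x \<in> q" "x \<in> S" by blast
  show "q \<subseteq> S"
  proof
    fix y assume y: "y \<in> q"
    show "y \<in> S"
    proof (cases "x = y")
      case False
      then have "{x, y} \<in> B"
        using doubleton_in_pairs[OF x(1) y] assms(4) unfolding cliques_def by blast
      then show ?thesis using assms(3) x(2) by blast
    qed (use x in simp)
  qed
qed

lemma graph_path_mono:
  "graph_path W G vs \<Longrightarrow> W \<subseteq> V \<Longrightarrow> G \<subseteq> H \<Longrightarrow> graph_path V H vs"
  unfolding graph_path_def by (auto elim: successively_mono)

text \<open>Induction on the number of vertices. A vertex of degree below \<open>k / 2\<close> is deleted, at a loss of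
strictly less than \<open>c\<close>, so that equality cannot occur. If there is none, a closed set \<open>S\<close> of at most
\<open>k\<close> vertices splits off; all counts are additive over \<open>S\<close> and \<open>V - S\<close>, and in the case of
equality both parts are extremal. The structure is recorded as a cover of \<open>V\<close> by blue \<open>k\<close>-cliques that no
pair of the graph leaves; this form passes directly from \<open>V - S\<close> to \<open>V\<close>.\<close>
lemma red_blue_bound:
  assumes rk: "r \<ge> 3" "k \<ge> r + 3" and c: "c = real (k choose r) / real k"
  assumes "finite V" "R \<subseteq> pairs V" "B \<subseteq> pairs V" "R \<inter> B = {}"
    and "\<And>vs. graph_path V (R \<union> B) vs \<Longrightarrow> length vs \<le> k"
  shows "real (card R) + real (card (cliques r B)) \<le> real (card V) * c \<and>
    (real (card R) + real (card (cliques r B)) = real (card V) * c \<longrightarrow>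
      (\<forall>v\<in>V. \<exists>S. v \<in> S \<and> S \<subseteq> V \<and> card S = k \<and> pairs S \<subseteq> B \<and>
        (\<forall>p\<in>R \<union> B. p \<subseteq> S \<or> p \<subseteq> V - S)))"
  using assms(4-)
proof (induction V arbitrary: R B rule: finite_psubset_induct)
  case (psubset V)
  note V = psubset.hyps and R = psubset.prems(1) and B = psubset.prems(2)
    and RB = psubset.prems(3) and path = psubset.prems(4)
  have r2: "r \<ge> 2" using rk by simp
  have fin: "finite R" "finite B" "finite (cliques r B)"
    using finite_subset[OF R finite_pairs[OF V]] finite_subset[OF B finite_pairs[OF V]]
      finite_cliques[OF V B r2] by auto
  have sub: "p \<subseteq> V" if "p \<in> R" for p using that R by (auto simp: pairs_def)
  have Rne: "{} \<notin> R" using R by (auto simp: pairs_def)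
  have Qne: "{} \<notin> cliques r B" using rk by (auto simp: cliques_def)
  note clsub = clique_subset[OF B _ r2]
  note clind = cliques_induced_edges[OF B r2]
  have IH: "real (card (induced_edges R W)) + real (card (cliques r (induced_edges B W))) \<le> real (card W) * c \<and>
    (real (card (induced_edges R W)) + real (card (cliques r (induced_edges B W))) = real (card W) * c \<longrightarrow>
      (\<forall>v\<in>W. \<exists>S. v \<in> S \<and> S \<subseteq> W \<and> card S = k \<and> pairs S \<subseteq> induced_edges B W \<and>
        (\<forall>p\<in>induced_edges R W \<union> induced_edges B W. p \<subseteq> S \<or> p \<subseteq> W - S)))"
    if W: "W \<subset> V" for W
  proof (rule psubset.IH[OF W])
    fix vs assume "graph_path W (induced_edges R W \<union> induced_edges B W) vs"
    then have "graph_path V (R \<union> B) vs"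
      by (rule graph_path_mono) (use W in \<open>auto simp: induced_edges_def\<close>)
    then show "length vs \<le> k" by (rule path)
  qed (use R B RB in \<open>auto simp: induced_edges_def pairs_def\<close>)
  show ?case
  proof (cases "V = {}")
    case True
    then have "p = {}" if "p \<in> R \<union> cliques r B" for p using that sub[of p] clsub[of p] by auto
    then have "R = {}" "cliques r B = {}" using Rne Qne by blast+
    then show ?thesis using True by simp
  next
    case ne: False
    show ?thesis
    proof (cases "\<exists>v\<in>V. 2 * card (neighbours (R \<union> B) v) < k")
      case True
      then obtain v where v: "v \<in> V" "2 * card (neighbours (R \<union> B) v) < k" by blast
      have "real (card {p \<in> R. v \<in> p}) + real (card {q \<in> cliques r B. v \<in> q}) < c"
        unfolding c by (rule loss_at_low_degree_vertex[OF rk V R B RB v(2)])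
      moreover have "real (card (induced_edges R (V - {v})))
          + real (card (cliques r (induced_edges B (V - {v})))) \<le> real (card (V - {v})) * c"
        using IH[of "V - {v}"] v(1) by blast
      moreover have "card R = card (induced_edges R (V - {v})) + card {p \<in> R. v \<in> p}"
        using card_delete_vertex[OF fin(1) sub] .
      moreover have "card (cliques r B) = card (cliques r (induced_edges B (V - {v})))
          + card {q \<in> cliques r B. v \<in> q}"
        unfolding clind using card_delete_vertex[OF fin(3) clsub] .
      moreover have "real (card V) * c = real (card (V - {v})) * c + c"
        unfolding card_Suc_Diff1[OF V v(1), symmetric]
        by (simp only: of_nat_Suc distrib_right mult_1_left add.commute)
      ultimately have "real (card R) + real (card (cliques r B)) < real (card V) * c" by linarith
      then show ?thesis by simp
    next
      case False
      then have deg: "\<And>v. v \<in> V \<Longrightarrow> 2 * card (neighbours (R \<union> B) v) \<ge> k" by (simp add: not_less)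
      obtain S where S: "S \<subseteq> V" "S \<noteq> {}" "card S \<le> k"
        and closed: "\<And>p. p \<in> R \<union> B \<Longrightarrow> p \<subseteq> S \<or> p \<subseteq> V - S"
        using closed_set_of_high_degrees[OF V _ ne path deg] R B by blast
      let ?T = "V - S"
      have finS: "finite S" using S(1) V finite_subset by blast
      have TV: "?T \<subset> V" using S by blast
      have cardR: "card R = card (induced_edges R S) + card (induced_edges R ?T)"
        by (rule card_split[OF fin(1) Rne closed]) simp
      have cardQ: "card (cliques r B) =
          card (cliques r (induced_edges B S)) + card (cliques r (induced_edges B ?T))"
        unfolding clind
        by (rule card_split[OF fin(3) Qne clique_in_closed_set[OF B r2 closed]]) auto
      have cardV: "real (card V) * c = real (card S) * c + real (card ?T) * c"
        using S(1) finS V card_mono[OF V S(1)]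
        by (simp add: card_Diff_subset of_nat_diff left_diff_distrib)
      have disj: "induced_edges R S \<inter> induced_edges B S = {}"
        using RB by (auto simp: induced_edges_def)
      note small = red_blue_count_small[OF rk finS S(2,3) induced_edges_subset_pairs[OF R]
          induced_edges_subset_pairs[OF B] disj, folded c]
      note rest = IH[OF TV]
      show ?thesis
      proof (intro conjI impI ballI)
        show "real (card R) + real (card (cliques r B)) \<le> real (card V) * c"
          using small(1) rest cardR cardQ cardV by linarith
      next
        fix v
        assume eq: "real (card R) + real (card (cliques r B)) = real (card V) * c" and v: "v \<in> V"
        have eqS: "real (card (induced_edges R S)) + real (card (cliques r (induced_edges B S)))
            = real (card S) * c"
          and eqT: "real (card (induced_edges R ?T)) + real (card (cliques r (induced_edges B ?T)))
            = real (card ?T) * c"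
          using eq small(1) rest cardR cardQ cardV by linarith+
        show "\<exists>S. v \<in> S \<and> S \<subseteq> V \<and> card S = k \<and> pairs S \<subseteq> B \<and> (\<forall>p\<in>R \<union> B. p \<subseteq> S \<or> p \<subseteq> V - S)"
        proof (cases "v \<in> S")
          case True
          have "card S = k" "pairs S \<subseteq> B"
            using small(2)[OF eqS] by (auto simp: induced_edges_def)
          then show ?thesis using True S(1) closed by blast
        next
          case False
          then obtain T where T: "v \<in> T" "T \<subseteq> ?T" "card T = k" "pairs T \<subseteq> induced_edges B ?T"
            and Tclosed: "\<forall>p\<in>induced_edges R ?T \<union> induced_edges B ?T. p \<subseteq> T \<or> p \<subseteq> ?T - T"
            using rest eqT v by (meson DiffI)
          have "p \<subseteq> T \<or> p \<subseteq> V - T" if p: "p \<in> R \<union> B" for p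
          proof (cases "p \<subseteq> S")
            case True
            then show ?thesis using T(2) S(1) by blast
          next
            case False
            then have "p \<in> induced_edges R ?T \<union> induced_edges B ?T"
              using closed[OF p] p by (auto simp: induced_edges_def)
            then show ?thesis using Tclosed by blast
          qed
          moreover have "pairs T \<subseteq> B" using T(4) by (auto simp: induced_edges_def)
          ultimately show ?thesis using T(1-3) by blast
        qed
      qed
    qed
  qed
qed

section \<open>From hypergraphs to red-blue graphs\<close>

text \<open>A family \<open>E2 \<subseteq> E\<close> maximising the excess \<open>card E2 - card (shadow of E2)\<close> satisfies two
Hall conditions. Adding edges to \<open>E2\<close> does not increase the excess, so the edges outside \<open>E2\<close> can be
matched to distinct pairs not in the shadow of \<open>E2\<close>: these are the red pairs. Removing edges does not
increase it either, so the shadow of \<open>E2\<close>, which is the set of blue pairs, can be matched into \<open>E2\<close>.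
Both matchings together give the system \<open>h\<close> of distinct representatives. Every edge in \<open>E2\<close>
is a blue clique because all of its pairs are in the shadow.\<close>
lemma red_blue_representation:
  assumes "finite V" "\<And>e. e \<in> E \<Longrightarrow> e \<subseteq> V \<and> card e = r"
  obtains R B E1 h where "R \<subseteq> pairs V" "B \<subseteq> pairs V" "R \<inter> B = {}"
    "E1 \<subseteq> E" "card E1 = card R" "E - E1 \<subseteq> cliques r B"
    "inj_on h (R \<union> B)" "\<And>p. p \<in> R \<union> B \<Longrightarrow> h p \<in> E \<and> p \<subseteq> h p"
proof -
  define sh where "sh = (\<lambda>X :: 'a set set. \<Union>e\<in>X. pairs e)"
  define excess where "excess = (\<lambda>X. int (card X) - int (card (sh X)))"
  have finE: "finite E" using assms by (intro finite_subset[of E "Pow V"]) auto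
  have shV: "sh X \<subseteq> pairs V" if "X \<subseteq> E" for X
    unfolding sh_def using that assms(2) pairs_mono by (meson UN_least subsetD)
  have finsh: "finite (sh X)" if "X \<subseteq> E" for X
    using finite_subset[OF shV[OF that] finite_pairs[OF assms(1)]] .
  have "Max (excess ` Pow E) \<in> excess ` Pow E" using finE by (intro Max_in) auto
  then obtain E2 where E2: "E2 \<subseteq> E" "excess E2 = Max (excess ` Pow E)" by auto
  have max: "excess X \<le> excess E2" if "X \<subseteq> E" for X unfolding E2(2) using finE that by (intro Max_ge) auto
  have finE2: "finite E2" using E2(1) finE finite_subset by blast
  define B where "B = sh E2"
  define E1 where "E1 = E - E2"
  have finE1: "finite E1" using finE by (simp add: E1_def)
  have finB: "finite B" unfolding B_def using finsh[OF E2(1)] .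
  have "\<exists>f. inj_on f E1 \<and> (\<forall>e\<in>E1. f e \<in> pairs e - B)"
  proof (rule hall[OF finE1])
    fix e assume "e \<in> E1"
    then have "e \<subseteq> V" using assms(2) by (simp add: E1_def)
    then have "finite e" using assms(1) by (rule finite_subset)
    then show "finite (pairs e - B)" using finite_pairs by blast
  next
    fix X assume X: "X \<subseteq> E1"
    have finX: "finite X" using X finE1 finite_subset by blast
    (* the comparison with X joined to E2 yields Hall's condition for X *)
    have XE: "X \<union> E2 \<subseteq> E" using X E2 by (auto simp: E1_def)
    have eq: "sh (X \<union> E2) = (\<Union>e\<in>X. pairs e - B) \<union> B" unfolding sh_def B_def by blast
    have "finite (\<Union>e\<in>X. pairs e - B)" using finsh[OF XE] unfolding eq by simp
    then have "card (sh (X \<union> E2)) = card (\<Union>e\<in>X. pairs e - B) + card B"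
      unfolding eq using finB by (intro card_Un_disjoint) auto
    moreover have "card (X \<union> E2) = card X + card E2"
      using X finX finE2 by (intro card_Un_disjoint) (auto simp: E1_def)
    ultimately show "card X \<le> card (\<Union>e\<in>X. pairs e - B)"
      using max[OF XE] unfolding excess_def B_def by linarith
  qed
  then obtain f where f: "inj_on f E1" "\<And>e. e \<in> E1 \<Longrightarrow> f e \<in> pairs e - B" by blast
  have "\<exists>g. inj_on g B \<and> (\<forall>p\<in>B. g p \<in> {e \<in> E2. p \<subseteq> e})"
  proof (rule hall[OF finB])
    fix P assume P: "P \<subseteq> B"
    (* the edges that meet P in some pair; discarding them from E2 destroys the pairs in P *)
    define Y where "Y = (\<Union>p\<in>P. {e \<in> E2. p \<subseteq> e})"
    have YE: "Y \<subseteq> E2" by (auto simp: Y_def)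
    have "sh (E2 - Y) \<subseteq> B - P" unfolding sh_def B_def Y_def pairs_def by blast
    then have "card (sh (E2 - Y)) \<le> card (B - P)" using finB by (intro card_mono) auto
    also have "\<dots> = card B - card P" using P finB finite_subset by (intro card_Diff_subset) auto
    finally have "card (sh (E2 - Y)) \<le> card B - card P" .
    moreover have "card P \<le> card B" using P finB by (intro card_mono)
    moreover have "card (E2 - Y) = card E2 - card Y"
      using YE finE2 finite_subset by (intro card_Diff_subset) auto
    moreover have "card Y \<le> card E2" using YE finE2 by (intro card_mono)
    moreover have "excess (E2 - Y) \<le> excess E2" using E2(1) by (intro max) auto
    ultimately have "card P \<le> card Y" unfolding excess_def B_def by linarith
    then show "card P \<le> card (\<Union>p\<in>P. {e \<in> E2. p \<subseteq> e})" unfolding Y_def .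
  qed (use finE2 in simp)
  then obtain g where g: "inj_on g B" "\<And>p. p \<in> B \<Longrightarrow> g p \<in> E2 \<and> p \<subseteq> g p" by blast
  define R where "R = f ` E1"
  define h where "h = (\<lambda>p. if p \<in> B then g p else inv_into E1 f p)"
  have RB: "R \<inter> B = {}" using f(2) by (auto simp: R_def)
  have hR: "h p \<in> E1 \<and> f (h p) = p" if "p \<in> R" for p
    using that RB by (auto simp: h_def R_def inv_into_into f_inv_into_f)
  have hB: "h p = g p" if "p \<in> B" for p using that by (simp add: h_def)
  show ?thesis
  proof (rule that[of R B E1 h])
    show "R \<subseteq> pairs V"
    proof
      fix p assume "p \<in> R"
      then obtain e where "e \<in> E1" "p = f e" by (auto simp: R_def)
      then have "p \<in> pairs e" "e \<subseteq> V" using f(2) assms(2) by (auto simp: E1_def)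
      then show "p \<in> pairs V" using pairs_mono by blast
    qed
    show "B \<subseteq> pairs V" unfolding B_def by (rule shV[OF E2(1)])
    show "R \<inter> B = {}" by (rule RB)
    show "E1 \<subseteq> E" by (auto simp: E1_def)
    show "card E1 = card R" unfolding R_def using card_image[OF f(1)] by simp
    show "E - E1 \<subseteq> cliques r B"
      using assms(2) E2(1) by (auto simp: E1_def cliques_def B_def sh_def)
    show "inj_on h (R \<union> B)"
    proof (rule inj_onI)
      fix p p' assume p: "p \<in> R \<union> B" "p' \<in> R \<union> B" "h p = h p'"
      have "h p \<in> E1 \<longleftrightarrow> p \<in> R" if "p \<in> R \<union> B" for p
        using that hR hB g(2) RB by (auto simp: E1_def)
      then consider "p \<in> R" "p' \<in> R" | "p \<in> B" "p' \<in> B" using p by (metis UnE)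
      then show "p = p'"
      proof cases
        case 1
        then show ?thesis using hR p(3) by metis
      next
        case 2
        then show ?thesis using hB p(3) inj_onD[OF g(1)] by metis
      qed
    qed
    show "h p \<in> E \<and> p \<subseteq> h p" if "p \<in> R \<union> B" for p
    proof (cases "p \<in> B")
      case True
      then show ?thesis using hB g(2) E2(1) by auto
    next
      case False
      then have "p \<in> R" using that by blast
      then have "h p \<in> E1" "p \<in> pairs (h p)" using hR[of p] f(2)[of "h p"] by auto
      then show ?thesis by (auto simp: E1_def pairs_def)
    qed
  qed
qed

text \<open>Consecutive pairs of a path are distinct because its vertices are, and \<open>h\<close> is injective; so the
representatives serve as the distinct hyperedges of a Berge path.\<close>
lemma berge_path_of_graph_path:
  assumes "graph_path V G vs" "length vs = Suc l"
    and "inj_on h G" "\<And>p. p \<in> G \<Longrightarrow> h p \<in> E \<and> p \<subseteq> h p"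
  shows "berge_path V E l vs (map (\<lambda>i. h {vs ! i, vs ! Suc i}) [0..<l])"
proof -
  have dist: "distinct vs" using assms(1) by (simp add: graph_path_def)
  have edge: "{vs ! i, vs ! Suc i} \<in> G" if "i < l" for i
    using assms(1,2) that by (simp add: graph_path_def successively_conv_nth)
  have "inj_on (\<lambda>i. h {vs ! i, vs ! Suc i}) {0..<l}"
  proof (rule inj_onI)
    fix i j assume ij: "i \<in> {0..<l}" "j \<in> {0..<l}"
      "h {vs ! i, vs ! Suc i} = h {vs ! j, vs ! Suc j}"
    then have "{vs ! i, vs ! Suc i} = {vs ! j, vs ! Suc j}"
      using inj_onD[OF assms(3)] edge by simp
    then consider "vs ! i = vs ! j" | "vs ! i = vs ! Suc j" "vs ! Suc i = vs ! j"
      by (auto simp: doubleton_eq_iff)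
    then show "i = j"
      using ij dist assms(2) by cases (auto simp: nth_eq_iff_index_eq)
  qed
  then show ?thesis
    using assms(1,2,4) edge unfolding berge_path_def graph_path_def
    by (auto simp: distinct_map)
qed

section \<open>The extremal structure and the theorem\<close>

text \<open>Since \<open>2 \<le> r \<le> card S\<close>, every pair in \<open>S\<close> extends to an \<open>r\<close>-subset of \<open>S\<close>, which is a
hyperedge; so \<open>S\<close> is connected in the shadow. No pair of the shadow leaves \<open>S\<close>, as it belongs to \<open>B\<close>.\<close>
lemma component_of_closed_clique:
  assumes E: "E = cliques r B" and B: "B \<subseteq> pairs V" and r: "2 \<le> r" "r \<le> card S"
    and S: "finite S" "v \<in> S" "S \<subseteq> V" "pairs S \<subseteq> B" "\<And>p. p \<in> B \<Longrightarrow> p \<subseteq> S \<or> p \<subseteq> V - S"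
  shows "({(u, w). {u, w} \<in> two_shadow E}\<^sup>* \<inter> V \<times> V) `` {v} = S"
proof (intro equalityI subsetI)
  fix u assume "u \<in> ({(u, w). {u, w} \<in> two_shadow E}\<^sup>* \<inter> V \<times> V) `` {v}"
  then have "(v, u) \<in> {(u, w). {u, w} \<in> two_shadow E}\<^sup>*" by blast
  then show "u \<in> S"
  proof (induction rule: rtrancl_induct)
    case (step y z)
    then obtain e where e: "e \<in> E" "{y, z} \<in> pairs e"
      by (auto simp: two_shadow_def pairs_def)
    then have "{y, z} \<in> B" unfolding E cliques_def by blast
    then show ?case using S(5) step.IH by blast
  qed (rule S(2))
next
  fix u assume u: "u \<in> S"
  have "(v, u) \<in> {(u, w). {u, w} \<in> two_shadow E}\<^sup>*"
  proof (cases "u = v")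
    case False
    have "card {v, u} = 2" using False by simp
    moreover obtain e where "{v, u} \<subseteq> e" "e \<subseteq> S" "card e = r"
      using exists_subset_between[of "{v, u}" r S] False u S(1,2) r by auto
    moreover from this have "e \<in> E"
      using pairs_mono[of e S] S(4) unfolding E cliques_def by blast
    ultimately have "{v, u} \<in> two_shadow E" unfolding two_shadow_def by blast
    then show ?thesis by blast
  qed simp
  then show "u \<in> ({(u, w). {u, w} \<in> two_shadow E}\<^sup>* \<inter> V \<times> V) `` {v}"
    using u S(2,3) by blast
qed

theorem corollary3p4:
  fixes r k n :: nat and V :: "'a set" and E :: "'a set set"
  assumes "r \<ge> 3" and "k \<ge> r + 3" and "n \<ge> k"
    and "uniform_hypergraph r V E" and "card V = n"
    and "\<not> (\<exists>vs es. berge_path V E k vs es)"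
  shows "real (card E) \<le> real n / real k * real (k choose r) \<and>
         (real (card E) = real n / real k * real (k choose r) \<longrightarrow>
            (\<forall>(C, F) \<in> components V E. is_complete_hypergraph r k C F))"
proof -
  have V: "finite V" and uni: "\<And>e. e \<in> E \<Longrightarrow> e \<subseteq> V \<and> card e = r"
    using assms(4) by (auto simp: uniform_hypergraph_def)
  have finE: "finite E" using V uni by (intro finite_subset[of E "Pow V"]) auto
  obtain R B E1 h where RB: "R \<subseteq> pairs V" "B \<subseteq> pairs V" "R \<inter> B = {}"
    and E1: "E1 \<subseteq> E" "card E1 = card R" "E - E1 \<subseteq> cliques r B"
    and h: "inj_on h (R \<union> B)" "\<And>p. p \<in> R \<union> B \<Longrightarrow> h p \<in> E \<and> p \<subseteq> h p"
    using red_blue_representation[OF V uni] by blast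
  have path: "length vs \<le> k" if vs: "graph_path V (R \<union> B) vs" for vs
  proof (rule ccontr)
    assume "\<not> length vs \<le> k"
    then have len: "length (take (Suc k) vs) = Suc k" by simp
    have "graph_path V (R \<union> B) (take (Suc k) vs @ drop (Suc k) vs)" using vs by simp
    then have "graph_path V (R \<union> B) (take (Suc k) vs)"
      unfolding graph_path_def by (simp only: successively_append_iff distinct_append set_append) simp
    from berge_path_of_graph_path[OF this len h] assms(6) show False by blast
  qed
  note bound = red_blue_bound[OF assms(1,2) refl V RB path, unfolded assms(5)]
  have finQ: "finite (cliques r B)" using finite_cliques[OF V RB(2)] assms(1) by simp
  have split: "card E = card R + card (E - E1)"
    using E1(1,2) finE card_mono[OF finE E1(1)] finite_subset[OF E1(1) finE]
    by (simp add: card_Diff_subset)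
  have le: "card (E - E1) \<le> card (cliques r B)" using E1(3) finQ by (rule card_mono[rotated])
  have rhs: "real n / real k * real (k choose r) = real n * (real (k choose r) / real k)" by simp
  show ?thesis unfolding rhs
  proof (intro conjI impI)
    show "real (card E) \<le> real n * (real (k choose r) / real k)" using bound split le by linarith
  next
    assume "real (card E) = real n * (real (k choose r) / real k)"
    then have eq: "real (card R) + real (card (cliques r B)) = real n * (real (k choose r) / real k)"
      and "card (E - E1) = card (cliques r B)"
      using bound split le by linarith+
    then have E2: "E - E1 = cliques r B" using E1(3) finQ by (simp add: card_subset_eq)
    have cover: "\<exists>S. v \<in> S \<and> S \<subseteq> V \<and> card S = k \<and> pairs S \<subseteq> B \<and>
        (\<forall>p\<in>R \<union> B. p \<subseteq> S \<or> p \<subseteq> V - S)" if "v \<in> V" for v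
      using bound eq that by blast
    (* a red pair would lie inside one of the sets covering V, where all pairs are blue *)
    have "R = {}"
    proof (rule equals0I)
      fix p assume p: "p \<in> R"
      then have p2: "p \<subseteq> V" "card p = 2" using RB(1) by (auto simp: pairs_def)
      then obtain v where v: "v \<in> p" by fastforce
      then have "v \<in> V" using p2 by blast
      from cover[OF this] obtain S where S: "v \<in> S" "pairs S \<subseteq> B"
        and closed: "\<forall>p\<in>R \<union> B. p \<subseteq> S \<or> p \<subseteq> V - S" by blast
      have "p \<subseteq> S" using bspec[OF closed, of p] p v S(1) by auto
      then have "p \<in> B" using p2(2) S(2) by (auto simp: pairs_def)
      then show False using p RB(3) by blast
    qed
    then have "E1 = {}" using E1(1,2) finE finite_subset by fastforce
    with E2 have E: "E = cliques r B" by simp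
    show "\<forall>(C, F) \<in> components V E. is_complete_hypergraph r k C F"
    proof (intro ballI, clarify)
      fix C F assume "(C, F) \<in> components V E"
      then obtain v where v: "v \<in> V" and F: "F = induced_edges E C"
        and C: "C = ({(u, w). {u, w} \<in> two_shadow E}\<^sup>* \<inter> V \<times> V) `` {v}"
        by (auto simp: components_def graph_components_def elim!: quotientE)
      from cover[OF v] obtain S where S: "v \<in> S" "S \<subseteq> V" "card S = k" "pairs S \<subseteq> B"
        and closed: "\<forall>p\<in>R \<union> B. p \<subseteq> S \<or> p \<subseteq> V - S" by blast
      have finS: "finite S" using S(2) V finite_subset by blast
      have "C = S" unfolding C
        by (rule component_of_closed_clique[OF E RB(2)]) (use S finS assms(1,2) closed in auto)
      moreover have "induced_edges E S = {e. e \<subseteq> S \<and> card e = r}"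
        using pairs_mono[of _ S] S(4) unfolding E induced_edges_def cliques_def by blast
      ultimately show "is_complete_hypergraph r k C F"
        unfolding is_complete_hypergraph_def F using finS S(3) by simp
    qed
  qed
qed

end
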